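(* Consider the simple bilevel problem $$\text{(P)}\quad \min_{x\in\mathbb{R}^n} f(x):=f_1(x)+f_2(x)\quad\text{s.t.}\quad x\in\arg\min_{z\in\mathbb{R}^n} g(z):=g_1(z)+g_2(z),$$ and suppose that: (i) $f_1$ and $g_1$ are convex and continuously differentiable, and their gradients $\nabla f_1$, $\nabla g_1$ are $L_{f_1}$- and $L_{g_1}$-Lipschitz continuous, respectively; (ii) $f_2$ and $g_2$ are proper, lower semicontinuous, convex, possibly non-smooth, and proximal-friendly; (iii) $f^*:=\inf_{x\in\mathbb{R}^n} f(x)>-\infty$ and $g^*:=\inf_{x\in\mathbb{R}^n} g(x)>-\infty$; in addition, $g$ is not strongly convex, and the lower-level problem $\min_{x\in\mathbb{R}^n} g(x)$ has multiple optimal solutions; (iv) for any fixed $c$, the function $h_c:=g_2+\delta_c$ is proximal-friendly, where $\delta_c(x)=0$ if $f(x)\le c$ and $\delta_c(x)=+\infty$ if $f(x)>c$. Let $p^*$ be the optimal value of (P). Then the algorithm Bisec-BiO (described in the context), run with tolerances $\epsilon_f,\epsilon_g$, produces an $(\epsilon_f,\epsilon_g)$-optimal solution of (P), i.e. a point $\hat x$ with $$f(\hat x)-p^*\le\epsilon_f\quad\text{and}\quad g(\hat x)-g^*\le\epsilon_g,$$ after at most $T$ evaluations of the function values $f_1$, $f_2$, $g_1$ and $g_2$, the gradients $\nabla f_1$ and $\nabla g_1$, and the calls of the proximal mapping with respect to the function $h_c$, where $$T=\tilde{\mathcal{O}}\left(\max\left\{\sqrt{\frac{L_{f_1}}{\epsilon_f}},\sqrt{\frac{L_{g_1}}{\epsilon_g}}\right\}\right)$$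 and $\tilde{\mathcal{O}}$ suppresses a logarithmic term.
   Context: Setting: $f_1,g_1:X\to\mathbb{R}$ are defined on an open set $X\subseteq\mathbb{R}^n$, and $f_2,g_2:\mathbb{R}^n\to\mathbb{R}\cup\{\infty\}$. Proximal-friendly: a function $h$ is proximal-friendly if its proximal mapping $\mathrm{prox}_h(y)=\arg\min_{x\in\mathbb{R}^n} h(x)+\frac12\|x-y\|^2$ is easy to compute. APG oracle: consider $\min_{x\in\mathbb{R}^n}\varphi(x):=\varphi_1(x)+\varphi_2(x)$, where $\varphi_1$ is convex and continuously differentiable on an open set with $L_{\varphi_1}$-Lipschitz continuous gradient, and $\varphi_2:\mathbb{R}^n\to\mathbb{R}\cup\{\infty\}$ is proper, lower semicontinuous, convex, possibly non-smooth, and proximal-friendly. Given a starting point $x_0\in\mathbb{R}^n$ and a tolerance $\epsilon$, $\mathrm{APG}(\varphi_1,\varphi_2,L_{\varphi_1},x_0,\epsilon)$ is a procedure that implements the classical FISTA scheme (an accelerated proximal gradient method) within $\mathcal{O}(\sqrt{L_{\varphi_1}/\epsilon})$ iterations to obtain an $\epsilon$-optimal solution of this problem, i.e. a point $\tilde x$ with $\varphi(\tilde x)-\inf\varphi\le\epsilon$. Algorithm Bisec-BiO (input $f_1,f_2,g_1,g_2,L_{f_1},L_{g_1},\epsilon_f,\epsilon_g$): 1. Invoke the APG oracles $\tilde x_f=\mathrm{APG}(f_1,f_2,L_{f_1},x_0^f,\epsilon_f/2)$ and $\tilde x_g=\mathrm{APG}(g_1,g_2,L_{g_1},x_0^g,\epsilon_g/2)$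 (with starting points $x_0^f,x_0^g\in\mathbb{R}^n$). Set $\tilde g=g(\tilde x_g)$ and the initial bounds $l=f(\tilde x_f)-\epsilon_f/2$, $u=f(\tilde x_g)$. 2. While $u-l>\epsilon_f$: let $c=\frac{l+u}{2}$ and invoke the APG oracle $\tilde x_c=\mathrm{APG}(g_1,h_c,L_{g_1},x_0^c,\epsilon_g/2)$ (with a starting point $x_0^c$) to obtain an approximate solution of $\min_{x\in\mathbb{R}^n} g(x)$ s.t. $f(x)\le c$. If $g(\tilde x_c)>\tilde g+\epsilon_g/2$, let $l=c$; otherwise let $u=f(\tilde x_c)$ (note $f(\tilde x_c)\le c$). 3. Let $c=u$ and return the corresponding $\tilde x_c$ as $\hat x$.
   Formalization: The formal version assumes the initial bound u = f(x̃_g) is finite (else bisection is undefined), sets l = c when no point of dom g has f ≤ c, returns the point attaining u, and puts a 1 in the maximum in T and in the oracle's iteration bound. *)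

theory Defs
  imports "HOL-Analysis.Analysis"
begin

definition proper_fun :: "('a \<Rightarrow> ereal) \<Rightarrow> bool" where
  "proper_fun h \<longleftrightarrow> (\<forall>x. h x \<noteq> -\<infinity>) \<and> (\<exists>x. h x \<noteq> \<infinity>)"

definition lsc :: "('a::topological_space \<Rightarrow> ereal) \<Rightarrow> bool" where
  "lsc h \<longleftrightarrow> (\<forall>x. h x \<le> Liminf (at x) h)"

definition convex_ext :: "('a::real_vector \<Rightarrow> ereal) \<Rightarrow> bool" where
  "convex_ext h \<longleftrightarrow> (\<forall>x y. \<forall>t\<in>{0<..<1::real}.
     h (t *\<^sub>R x + (1 - t) *\<^sub>R y) \<le> ereal t * h x + ereal (1 - t) * h y)"

definition strongly_convex :: "('a::real_normed_vector \<Rightarrow> ereal) \<Rightarrow> bool" where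
  "strongly_convex h \<longleftrightarrow> (\<exists>\<mu>>0. \<forall>x y. \<forall>t\<in>{0<..<1::real}.
     h (t *\<^sub>R x + (1 - t) *\<^sub>R y)
       \<le> ereal t * h x + ereal (1 - t) * h y - ereal (\<mu> / 2 * t * (1 - t) * (norm (x - y))\<^sup>2))"

definition argmin :: "('a \<Rightarrow> ereal) \<Rightarrow> 'a set" where
  "argmin h = {x. is_arg_min h (\<lambda>_. True) x}"

definition smooth_convex ::
  "'a::euclidean_space set \<Rightarrow> ('a \<Rightarrow> real) \<Rightarrow> ('a \<Rightarrow> 'a) \<Rightarrow> real \<Rightarrow> bool" where
  "smooth_convex X h dh L \<longleftrightarrow> convex_on X h \<and> (\<forall>x\<in>X. GDERIV h x :> dh x) \<and>
     continuous_on X dh \<and> L-lipschitz_on X dh"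

definition prox :: "('a::real_normed_vector \<Rightarrow> ereal) \<Rightarrow> 'a \<Rightarrow> 'a set" where
  "prox h y = argmin (\<lambda>x. h x + ereal ((norm (x - y))\<^sup>2 / 2))"

text \<open>``Easy to compute'' is modelled as access to a unit-cost procedure \<^term>\<open>p\<close> that evaluates
  the proximal mapping of \<open>\<lambda> h\<close> for every step size \<open>\<lambda> > 0\<close>; its calls are counted below.\<close>

definition proximal_friendly ::
  "('a::real_normed_vector \<Rightarrow> ereal) \<Rightarrow> (real \<Rightarrow> 'a \<Rightarrow> 'a) \<Rightarrow> bool" where
  "proximal_friendly h p \<longleftrightarrow> (\<forall>lam>0. \<forall>y. p lam y \<in> prox (\<lambda>x. ereal lam * h x) y)"

text \<open>The fields \<open>f1\<close>, \<open>df1\<close>, \<open>g1\<close>, \<open>dg1\<close> are meaningful on \<open>smooth_dom\<close> only.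
  \<open>prox_h c\<close> evaluates the proximal mappings of \<open>h\<^sub>c\<close>.\<close>

record 'a bilevel =
  smooth_dom :: "'a set"
  f1 :: "'a \<Rightarrow> real"
  df1 :: "'a \<Rightarrow> 'a"
  Lf :: real
  f2 :: "'a \<Rightarrow> ereal"
  prox_f :: "real \<Rightarrow> 'a \<Rightarrow> 'a"
  g1 :: "'a \<Rightarrow> real"
  dg1 :: "'a \<Rightarrow> 'a"
  Lg :: real
  g2 :: "'a \<Rightarrow> ereal"
  prox_g :: "real \<Rightarrow> 'a \<Rightarrow> 'a"
  prox_h :: "real \<Rightarrow> real \<Rightarrow> 'a \<Rightarrow> 'a"

definition composite :: "('a \<Rightarrow> real) \<Rightarrow> ('a \<Rightarrow> ereal) \<Rightarrow> 'a \<Rightarrow> ereal" where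
  "composite h1 h2 x = ereal (h1 x) + h2 x"

definition obj_f :: "'a bilevel \<Rightarrow> 'a \<Rightarrow> ereal" where
  "obj_f B = composite (f1 B) (f2 B)"

definition obj_g :: "'a bilevel \<Rightarrow> 'a \<Rightarrow> ereal" where
  "obj_g B = composite (g1 B) (g2 B)"

definition level_indicator :: "('a \<Rightarrow> ereal) \<Rightarrow> real \<Rightarrow> 'a \<Rightarrow> ereal" where
  "level_indicator h c x = (if h x \<le> ereal c then 0 else \<infinity>)"

definition h_level :: "'a bilevel \<Rightarrow> real \<Rightarrow> 'a \<Rightarrow> ereal" where
  "h_level B c x = g2 B x + level_indicator (obj_f B) c x"

definition opt_value :: "'a bilevel \<Rightarrow> ereal" where
  "opt_value B = (INF x\<in>argmin (obj_g B). obj_f B x)"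

text \<open>The inclusions of the effective domains of \<open>f2\<close> and \<open>g2\<close> in \<open>smooth_dom\<close> make
  \<open>f1 + f2\<close> and \<open>g1 + g2\<close> well defined on the whole space.\<close>

definition bilevel_assms :: "'a::euclidean_space bilevel \<Rightarrow> bool" where
  "bilevel_assms B \<longleftrightarrow>
     open (smooth_dom B) \<and>
     {x. f2 B x \<noteq> \<infinity>} \<subseteq> smooth_dom B \<and> {x. g2 B x \<noteq> \<infinity>} \<subseteq> smooth_dom B \<and>
     smooth_convex (smooth_dom B) (f1 B) (df1 B) (Lf B) \<and>
     smooth_convex (smooth_dom B) (g1 B) (dg1 B) (Lg B) \<and>
     proper_fun (f2 B) \<and> lsc (f2 B) \<and> convex_ext (f2 B) \<and> proximal_friendly (f2 B) (prox_f B) \<and>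
     proper_fun (g2 B) \<and> lsc (g2 B) \<and> convex_ext (g2 B) \<and> proximal_friendly (g2 B) (prox_g B) \<and>
     (INF x. obj_f B x) > -\<infinity> \<and> (INF x. obj_g B x) > -\<infinity> \<and>
     \<not> strongly_convex (obj_g B) \<and>
     (\<exists>x y. x \<noteq> y \<and> x \<in> argmin (obj_g B) \<and> y \<in> argmin (obj_g B)) \<and>
     (\<forall>c. proximal_friendly (h_level B c) (prox_h B c))"

text \<open>\<open>fista_t k\<close> is the classical \<open>t\<^bsub>k+1\<^esub>\<close>, and \<open>fista \<dots> k\<close> is the pair
  \<open>(x\<^bsub>k\<^esub>, y\<^bsub>k+1\<^esub>)\<close>.  One iteration uses one gradient and one proximal mapping.\<close>

fun fista_t :: "nat \<Rightarrow> real" where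
  "fista_t 0 = 1"
| "fista_t (Suc k) = (1 + sqrt (1 + 4 * (fista_t k)\<^sup>2)) / 2"

fun fista ::
  "('a::real_vector \<Rightarrow> 'a) \<Rightarrow> (real \<Rightarrow> 'a \<Rightarrow> 'a) \<Rightarrow> real \<Rightarrow> 'a \<Rightarrow> nat \<Rightarrow> 'a \<times> 'a" where
  "fista dh p L x0 0 = (x0, x0)"
| "fista dh p L x0 (Suc k) =
     (let (x, y) = fista dh p L x0 k;
          x' = p (1 / L) (y - (1 / L) *\<^sub>R dh y)
      in (x', x' + ((fista_t k - 1) / fista_t (Suc k)) *\<^sub>R (x' - x)))"

text \<open>\<open>apg C h1 dh1 h2 p2 L x0 \<epsilon> x k\<close>: the oracle, started at \<open>x0\<close>, returns the iterate \<open>x\<close> of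
  FISTA after \<open>k\<close> iterations.  \<open>C\<close> is the constant hidden in its iteration bound
  \<open>O(sqrt (L / \<epsilon>))\<close>; the maximum with 1 extends the bound, which is asymptotic for
  small \<open>\<epsilon>\<close>, to all \<open>\<epsilon> > 0\<close>.  No single \<open>C\<close> serves all problems and starting points, so
  the contract is attached to the individual call.\<close>

definition apg ::
  "real \<Rightarrow> ('a::real_vector \<Rightarrow> real) \<Rightarrow> ('a \<Rightarrow> 'a) \<Rightarrow> ('a \<Rightarrow> ereal) \<Rightarrow> (real \<Rightarrow> 'a \<Rightarrow> 'a) \<Rightarrow>
   real \<Rightarrow> 'a \<Rightarrow> real \<Rightarrow> 'a \<Rightarrow> nat \<Rightarrow> bool" where
  "apg C h1 dh1 h2 p2 L x0 \<epsilon> x k \<longleftrightarrow>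
     x = fst (fista dh1 p2 L x0 k) \<and>
     real k \<le> C * max 1 (sqrt (L / \<epsilon>)) \<and>
     composite h1 h2 x - (INF z. composite h1 h2 z) \<le> ereal \<epsilon>"

text \<open>\<open>incumbent\<close> is the point at which the current upper bound is attained,
  \<open>f incumbent = upper\<close>; it is the point returned at the end.  \<open>evals\<close> counts the
  evaluations of \<open>f1\<close>, \<open>f2\<close>, \<open>g1\<close>, \<open>g2\<close>, of both gradients, and of all proximal mappings.\<close>

record 'a bisec_state =
  lower :: real
  upper :: real
  gtilde :: real
  incumbent :: 'a
  evals :: nat

text \<open>Function values computed here: \<open>f\<close> at \<open>xf\<close> and \<open>xg\<close>, and \<open>g\<close> at \<open>xg\<close>.
  The bounds are real numbers, so the initial upper bound \<open>f xg\<close> has to be finite;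
  with an infinite one bisection is not defined.\<close>

definition bisec_init ::
  "real \<Rightarrow> 'a::euclidean_space bilevel \<Rightarrow> real \<Rightarrow> real \<Rightarrow> 'a bisec_state \<Rightarrow> bool" where
  "bisec_init C B \<epsilon>f \<epsilon>g s \<longleftrightarrow>
     (\<exists>x0f x0g xf xg kf kg.
        apg C (f1 B) (df1 B) (f2 B) (prox_f B) (Lf B) x0f (\<epsilon>f / 2) xf kf \<and>
        apg C (g1 B) (dg1 B) (g2 B) (prox_g B) (Lg B) x0g (\<epsilon>g / 2) xg kg \<and>
        ereal (gtilde s) = obj_g B xg \<and>
        ereal (lower s) = obj_f B xf - ereal (\<epsilon>f / 2) \<and>
        ereal (upper s) = obj_f B xg \<and>
        incumbent s = xg \<and>
        evals s = 2 * kf + 2 * kg + 6)"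

text \<open>If no point of the effective domain of \<open>g\<close> satisfies \<open>f \<le> c\<close>, then \<open>h\<^sub>c\<close> is not proper
  and the oracle is not applicable; the optimal value of the subproblem is then \<open>\<infinity>\<close>, which
  belongs to the case \<open>l = c\<close>, and one call of the proximal mapping of \<open>h\<^sub>c\<close> is charged.\<close>

definition bisec_step ::
  "real \<Rightarrow> 'a::euclidean_space bilevel \<Rightarrow> real \<Rightarrow> 'a bisec_state \<Rightarrow> 'a bisec_state \<Rightarrow> bool" where
  "bisec_step C B \<epsilon>g s s' \<longleftrightarrow>
     (let c = (lower s + upper s) / 2 in
      if \<forall>x. h_level B c x = \<infinity>
      then s' = s\<lparr>lower := c, evals := evals s + 1\<rparr>
      else \<exists>x0 x k.
        apg C (g1 B) (dg1 B) (h_level B c) (prox_h B c) (Lg B) x0 (\<epsilon>g / 2) x k \<and>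
        (if obj_g B x > ereal (gtilde s + \<epsilon>g / 2)
         then s' = s\<lparr>lower := c, evals := evals s + 2 * k + 2\<rparr>
         else s' = s\<lparr>upper := real_of_ereal (obj_f B x), incumbent := x,
                     evals := evals s + 2 * k + 4\<rparr>))"

definition bisec_run ::
  "real \<Rightarrow> 'a::euclidean_space bilevel \<Rightarrow> real \<Rightarrow> real \<Rightarrow> (nat \<Rightarrow> 'a bisec_state) \<Rightarrow> bool" where
  "bisec_run C B \<epsilon>f \<epsilon>g s \<longleftrightarrow> bisec_init C B \<epsilon>f \<epsilon>g (s 0) \<and>
     (\<forall>n. upper (s n) - lower (s n) > \<epsilon>f \<longrightarrow> bisec_step C B \<epsilon>g (s n) (s (Suc n)))"

definition halts_at :: "real \<Rightarrow> (nat \<Rightarrow> 'a bisec_state) \<Rightarrow> nat \<Rightarrow> bool" where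
  "halts_at \<epsilon>f s N \<longleftrightarrow> upper (s N) - lower (s N) \<le> \<epsilon>f \<and>
     (\<forall>n<N. upper (s n) - lower (s n) > \<epsilon>f)"

end

theory Submission
  imports Defs
begin

text \<open>Bisection on the optimal value \<open>p\<^sup>*\<close>: a level \<open>c\<close> is raised to the lower bound only if the
  subproblem \<open>min g\<close> subject to \<open>f \<le> c\<close> is infeasible or its value exceeds \<open>gtilde \<ge> g\<^sup>*\<close>; in
  both cases no minimiser of \<open>g\<close> has \<open>f \<le> c\<close>, so \<open>c \<le> p\<^sup>*\<close>.  Otherwise the
  new incumbent has \<open>g \<le> gtilde + \<epsilon>g / 2 \<le> g\<^sup>* + \<epsilon>g\<close>.  The gap between the bounds at least halves
  in each step, which gives the logarithmic number of oracle calls.\<close>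

text \<open>The two bounds on \<open>gtilde s\<close> serve opposite directions: lying above the
  infimum of g makes raising the lower bound sound, and lying at most \<open>\<epsilon>g / 2\<close>
  above it keeps accepted points within \<open>\<epsilon>g\<close>.\<close>

definition bisec_inv :: "'a::euclidean_space bilevel \<Rightarrow> real \<Rightarrow> 'a bisec_state \<Rightarrow> bool" where
  "bisec_inv B \<epsilon>g s \<longleftrightarrow>
     ereal (lower s) \<le> opt_value B \<and>
     obj_f B (incumbent s) = ereal (upper s) \<and>
     obj_g B (incumbent s) \<le> ereal (gtilde s + \<epsilon>g / 2) \<and>
     (INF x. obj_g B x) \<le> ereal (gtilde s) \<and>
     ereal (gtilde s) \<le> (INF x. obj_g B x) + ereal (\<epsilon>g / 2)"

section \<open>Finiteness of the infima and bounds on the optimal value\<close>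

lemma INF_composite_less_top:
  assumes "h2 x \<noteq> (\<infinity>::ereal)"
  shows "(INF z. composite h1 h2 z) \<noteq> \<infinity>"
proof -
  have "(INF z. composite h1 h2 z) \<le> composite h1 h2 x"
    by (rule INF_lower) simp
  also have "\<dots> < \<infinity>"
    using assms by (cases "h2 x") (auto simp: composite_def)
  finally show ?thesis by auto
qed

lemma INF_obj_f_finite:
  assumes "bilevel_assms B"
  shows "\<bar>INF x. obj_f B x\<bar> \<noteq> \<infinity>"
proof -
  obtain x where "f2 B x \<noteq> \<infinity>"
    using assms by (auto simp: bilevel_assms_def proper_fun_def)
  then have "(INF z. obj_f B z) \<noteq> \<infinity>"
    unfolding obj_f_def by (rule INF_composite_less_top)
  moreover have "(INF z. obj_f B z) > -\<infinity>"
    using assms by (auto simp: bilevel_assms_def)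
  ultimately show ?thesis by auto
qed

lemma INF_obj_g_finite:
  assumes "bilevel_assms B"
  shows "\<bar>INF x. obj_g B x\<bar> \<noteq> \<infinity>"
proof -
  obtain x where "g2 B x \<noteq> \<infinity>"
    using assms by (auto simp: bilevel_assms_def proper_fun_def)
  then have "(INF z. obj_g B z) \<noteq> \<infinity>"
    unfolding obj_g_def by (rule INF_composite_less_top)
  moreover have "(INF z. obj_g B z) > -\<infinity>"
    using assms by (auto simp: bilevel_assms_def)
  ultimately show ?thesis by auto
qed

lemma argmin_eq_INF:
  assumes "x \<in> argmin h"
  shows "h x = (INF z. h z)"
proof (rule antisym)
  show "h x \<le> (INF z. h z)"
    using assms by (auto simp: argmin_def is_arg_min_def not_less intro!: INF_greatest)
qed (simp add: INF_lower)

lemma INF_obj_f_le_opt_value: "(INF x. obj_f B x) \<le> opt_value B"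
  unfolding opt_value_def by (rule INF_superset_mono) auto

lemma le_opt_valueI:
  assumes "\<And>x. x \<in> argmin (obj_g B) \<Longrightarrow> \<not> obj_f B x \<le> ereal c"
  shows "ereal c \<le> opt_value B"
  unfolding opt_value_def using assms by (auto intro!: INF_greatest simp: not_le less_imp_le)

section \<open>The level-constrained subproblem and its oracle\<close>

lemma obj_g_le_composite_h_level:
  assumes "bilevel_assms B"
  shows "obj_g B x \<le> composite (g1 B) (h_level B c) x"
  using assms
  by (cases "g2 B x")
    (auto simp: obj_g_def composite_def h_level_def level_indicator_def
      bilevel_assms_def proper_fun_def)

lemma composite_h_level_eq:
  assumes "obj_f B x \<le> ereal c"
  shows "composite (g1 B) (h_level B c) x = obj_g B x"
  using assms by (simp add: obj_g_def composite_def h_level_def level_indicator_def)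

lemma composite_h_level_infeasible:
  assumes "bilevel_assms B" "\<not> obj_f B x \<le> ereal c"
  shows "composite (g1 B) (h_level B c) x = \<infinity>"
proof -
  have "g2 B x \<noteq> -\<infinity>"
    using assms(1) by (auto simp: bilevel_assms_def proper_fun_def)
  then show ?thesis
    using assms(2) by (cases "g2 B x") (auto simp: composite_def h_level_def level_indicator_def)
qed

lemma apg_value_le:
  assumes "apg C h1 dh1 h2 p2 L x0 \<epsilon> x k" and "\<bar>INF z. composite h1 h2 z\<bar> \<noteq> \<infinity>"
  shows "composite h1 h2 x \<le> (INF z. composite h1 h2 z) + ereal \<epsilon>"
proof -
  have "composite h1 h2 x - (INF z. composite h1 h2 z) \<le> ereal \<epsilon>"
    using assms(1) unfolding apg_def by blast
  then show ?thesis
    using ereal_minus_le[OF assms(2)] by (simp only: add.commute)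
qed

text \<open>The infimum of the subproblem is finite: a point with finite \<open>h_level\<close>
  bounds it above, and the infimum of g bounds it below. An approximate solution therefore has a
  value below infinity, which excludes infeasible points; on the level set the objective is g
  itself.\<close>

lemma apg_level_feasible:
  assumes B: "bilevel_assms B"
    and feas: "\<not> (\<forall>x. h_level B c x = \<infinity>)"
    and apg: "apg C (g1 B) (dg1 B) (h_level B c) p L x0 \<epsilon> x k"
  shows "obj_f B x \<le> ereal c"
    and "obj_g B x \<le> (INF z. composite (g1 B) (h_level B c) z) + ereal \<epsilon>"
proof -
  define I where "I = (INF z. composite (g1 B) (h_level B c) z)"
  obtain y where "h_level B c y \<noteq> \<infinity>"
    using feas by blast
  then have "I \<noteq> \<infinity>"
    unfolding I_def by (rule INF_composite_less_top)
  moreover have "(INF z. obj_g B z) \<le> I"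
    unfolding I_def by (rule INF_mono) (use obj_g_le_composite_h_level[OF B] in blast)
  ultimately have I: "\<bar>I\<bar> \<noteq> \<infinity>"
    using INF_obj_g_finite[OF B] by (cases I) auto
  have le: "composite (g1 B) (h_level B c) x \<le> I + ereal \<epsilon>"
    using apg_value_le[OF apg] I unfolding I_def by blast
  then show f_le: "obj_f B x \<le> ereal c"
    using composite_h_level_infeasible[OF B, of x c] I by (cases I) fastforce+
  show "obj_g B x \<le> (INF z. composite (g1 B) (h_level B c) z) + ereal \<epsilon>"
    using le composite_h_level_eq[OF f_le] by (simp add: I_def)
qed

section \<open>Correctness of the bisection bounds\<close>

lemma bisec_init_inv:
  assumes B: "bilevel_assms B" and "\<epsilon>g > 0" and init: "bisec_init C B \<epsilon>f \<epsilon>g s"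
  shows "bisec_inv B \<epsilon>g s" and "lower s \<le> upper s"
proof -
  obtain x0f x0g xf xg kf kg where
    af: "apg C (f1 B) (df1 B) (f2 B) (prox_f B) (Lf B) x0f (\<epsilon>f / 2) xf kf" and
    ag: "apg C (g1 B) (dg1 B) (g2 B) (prox_g B) (Lg B) x0g (\<epsilon>g / 2) xg kg" and
    s: "ereal (gtilde s) = obj_g B xg" "ereal (lower s) = obj_f B xf - ereal (\<epsilon>f / 2)"
      "ereal (upper s) = obj_f B xg" "incumbent s = xg"
    using init unfolding bisec_init_def by blast
  have "obj_f B xf \<le> (INF x. obj_f B x) + ereal (\<epsilon>f / 2)"
    using apg_value_le[OF af] INF_obj_f_finite[OF B] unfolding obj_f_def by blast
  \<comment> \<open>Subtracting the oracle's own tolerance turns an approximate minimum into a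
    certified lower bound.\<close>
  then have low: "ereal (lower s) \<le> (INF x. obj_f B x)"
    by (simp add: s ereal_minus_le add.commute)
  have "ereal (lower s) \<le> ereal (upper s)"
    unfolding s(3) by (rule order_trans[OF low]) (simp add: INF_lower)
  then show "lower s \<le> upper s" by simp
  have "obj_g B xg \<le> (INF x. obj_g B x) + ereal (\<epsilon>g / 2)"
    using apg_value_le[OF ag] INF_obj_g_finite[OF B] unfolding obj_g_def by blast
  moreover have "(INF x. obj_g B x) \<le> obj_g B xg"
    by (simp add: INF_lower)
  ultimately show "bisec_inv B \<epsilon>g s"
    using \<open>\<epsilon>g > 0\<close> order_trans[OF low INF_obj_f_le_opt_value]
    by (simp add: bisec_inv_def s(4) s(1,3)[symmetric])
qed

text \<open>Raising the lower bound to the midpoint halves the gap exactly. An accepted point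
  satisfies f \<le> c, so the new upper bound may fall below the midpoint, possibly even below
  \<open>lower s\<close>; hence only an inequality for the gap.\<close>

lemma bisec_step_inv:
  assumes B: "bilevel_assms B" and inv: "bisec_inv B \<epsilon>g s" and step: "bisec_step C B \<epsilon>g s s'"
  shows "bisec_inv B \<epsilon>g s'"
    and "upper s' - lower s' \<le> (upper s - lower s) / 2"
proof -
  define c where "c = (lower s + upper s) / 2"
  have "bisec_inv B \<epsilon>g s' \<and> upper s' - lower s' \<le> (upper s - lower s) / 2"
  proof (cases "\<forall>x. h_level B c x = \<infinity>")
    case True
    have s': "s' = s\<lparr>lower := c, evals := evals s + 1\<rparr>"
      using step True by (simp add: bisec_step_def c_def[symmetric] Let_def)
    \<comment> \<open>A minimiser of g in the empty feasible set would force the infimum of g to be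
      infinite.\<close>
    have "ereal c \<le> opt_value B"
    proof (rule le_opt_valueI, rule notI)
      fix x assume "x \<in> argmin (obj_g B)" and "obj_f B x \<le> ereal c"
      then have "(INF z. obj_g B z) = \<infinity>"
        using composite_h_level_eq[of B x c] True
        by (simp add: argmin_eq_INF[symmetric] composite_def)
      then show False using INF_obj_g_finite[OF B] by simp
    qed
    then show ?thesis using inv by (simp add: bisec_inv_def s' c_def field_simps)
  next
    case False
    obtain x0 x k where
      apg: "apg C (g1 B) (dg1 B) (h_level B c) (prox_h B c) (Lg B) x0 (\<epsilon>g / 2) x k" and
      s': "if obj_g B x > ereal (gtilde s + \<epsilon>g / 2)
         then s' = s\<lparr>lower := c, evals := evals s + 2 * k + 2\<rparr>
         else s' = s\<lparr>upper := real_of_ereal (obj_f B x), incumbent := x,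
                     evals := evals s + 2 * k + 4\<rparr>"
      using step unfolding bisec_step_def c_def[symmetric] Let_def if_not_P[OF False] by blast
    note x = apg_level_feasible[OF B False apg]
    show ?thesis
    proof (cases "obj_g B x > ereal (gtilde s + \<epsilon>g / 2)")
      case True
      \<comment> \<open>A minimiser of g with f \<le> c would bound the subproblem's infimum by
        \<open>gtilde s\<close>. The oracle loses at most \<open>\<epsilon>g / 2\<close>, exactly
        the slack in the test, so the test could not have failed.\<close>
      have "ereal c \<le> opt_value B"
      proof (rule le_opt_valueI, rule notI)
        fix z assume z: "z \<in> argmin (obj_g B)" and "obj_f B z \<le> ereal c"
        then have "(INF z. composite (g1 B) (h_level B c) z) \<le> obj_g B z"
          by (metis INF_lower UNIV_I composite_h_level_eq)
        also have "\<dots> \<le> ereal (gtilde s)"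
          using inv by (simp add: argmin_eq_INF[OF z] bisec_inv_def)
        finally have "obj_g B x \<le> ereal (gtilde s) + ereal (\<epsilon>g / 2)"
          using x(2) by (meson add_right_mono order_trans)
        then show False using True by simp
      qed
      then show ?thesis using inv s' True by (simp add: bisec_inv_def c_def field_simps)
    next
      case False
      have "(INF z. obj_f B z) \<le> obj_f B x"
        by (simp add: INF_lower)
      \<comment> \<open>Finiteness ensures that \<open>real_of_ereal\<close> in the update returns
        the true value and not its default 0.\<close>
      then obtain r where r: "obj_f B x = ereal r"
        using x(1) INF_obj_f_finite[OF B] by (cases "obj_f B x") auto
      then have "r \<le> c" using x(1) by simp
      then show ?thesis
        using inv s' False r by (simp add: bisec_inv_def c_def field_simps)
    qed
  qed
  then show "bisec_inv B \<epsilon>g s'"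
    and "upper s' - lower s' \<le> (upper s - lower s) / 2" by auto
qed

section \<open>Counting evaluations\<close>

lemma apg_iterations_le:
  assumes apg: "apg C h1 dh1 h2 p2 L x0 (\<epsilon> / 2) x k"
    and M: "1 \<le> M" "sqrt (L / \<epsilon>) \<le> M"
  shows "real k \<le> 2 * \<bar>C\<bar> * M"
proof -
  have "sqrt (L / (\<epsilon> / 2)) = sqrt 2 * sqrt (L / \<epsilon>)"
    by (simp add: real_sqrt_mult[symmetric] mult.commute)
  also have "\<dots> \<le> sqrt 2 * M"
    using M by (intro mult_left_mono) auto
  \<comment> \<open>Halving the tolerance costs a factor \<open>sqrt 2\<close>, rounded up to
    2.\<close>
  also have "\<dots> \<le> 2 * M"
    using M sqrt2_less_2 by (intro mult_right_mono) auto
  finally have m: "max 1 (sqrt (L / (\<epsilon> / 2))) \<le> 2 * M"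
    using M by simp
  have "real k \<le> C * max 1 (sqrt (L / (\<epsilon> / 2)))"
    using apg by (simp add: apg_def)
  \<comment> \<open>\<open>C\<close> may be negative; its absolute value permits multiplying the
    previous bound by it.\<close>
  also have "\<dots> \<le> \<bar>C\<bar> * max 1 (sqrt (L / (\<epsilon> / 2)))"
    by (intro mult_right_mono) auto
  also have "\<dots> \<le> \<bar>C\<bar> * (2 * M)"
    using m by (intro mult_left_mono) auto
  finally show ?thesis by simp
qed

lemma bisec_init_evals_le:
  assumes "bisec_init C B \<epsilon>f \<epsilon>g s"
    and M: "1 \<le> M" "sqrt (Lf B / \<epsilon>f) \<le> M" "sqrt (Lg B / \<epsilon>g) \<le> M"
  shows "real (evals s) \<le> (8 * \<bar>C\<bar> + 6) * M"
proof -
  obtain x0f x0g xf xg kf kg where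
    "apg C (f1 B) (df1 B) (f2 B) (prox_f B) (Lf B) x0f (\<epsilon>f / 2) xf kf" and
    "apg C (g1 B) (dg1 B) (g2 B) (prox_g B) (Lg B) x0g (\<epsilon>g / 2) xg kg" and
    e: "evals s = 2 * kf + 2 * kg + 6"
    using assms(1) unfolding bisec_init_def by blast
  then have "real kf \<le> 2 * \<bar>C\<bar> * M" "real kg \<le> 2 * \<bar>C\<bar> * M"
    using M by (auto intro: apg_iterations_le)
  \<comment> \<open>Two calls, two evaluations per iteration and at most
    \<open>2 * \<bar>C\<bar> * M\<close> iterations each give the 8; the 6 function values are
    absorbed by 1 \<le> \<open>M\<close>.\<close>
  then show ?thesis using M(1) e by (simp add: algebra_simps)
qed

lemma bisec_step_evals_le:
  assumes step: "bisec_step C B \<epsilon>g s s'"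
    and M: "1 \<le> M" "sqrt (Lg B / \<epsilon>g) \<le> M"
  shows "real (evals s') \<le> real (evals s) + (4 * \<bar>C\<bar> + 4) * M"
proof -
  define c where "c = (lower s + upper s) / 2"
  show ?thesis
  proof (cases "\<forall>x. h_level B c x = \<infinity>")
    case True
    then have "evals s' = evals s + 1"
      using step by (simp add: bisec_step_def c_def[symmetric] Let_def)
    then show ?thesis
      using mult_mono[of 1 "4 * \<bar>C\<bar> + 4" 1 M] M by simp
  next
    case False
    obtain x0 x k where
      apg: "apg C (g1 B) (dg1 B) (h_level B c) (prox_h B c) (Lg B) x0 (\<epsilon>g / 2) x k" and
      "evals s' \<le> evals s + 2 * k + 4"
      using step unfolding bisec_step_def c_def[symmetric] Let_def if_not_P[OF False]
      by (fastforce split: if_splits)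
    moreover have "real k \<le> 2 * \<bar>C\<bar> * M"
      using apg M by (rule apg_iterations_le)
    ultimately show ?thesis using M by (simp add: algebra_simps)
  qed
qed

section \<open>Behaviour of a run up to its halting index\<close>

lemma bisec_run_prefix:
  assumes B: "bilevel_assms B" and "\<epsilon>g > 0" and run: "bisec_run C B \<epsilon>f \<epsilon>g s"
    and M: "1 \<le> M" "sqrt (Lf B / \<epsilon>f) \<le> M" "sqrt (Lg B / \<epsilon>g) \<le> M"
    and "\<And>m. m < n \<Longrightarrow> upper (s m) - lower (s m) > \<epsilon>f"
  shows "bisec_inv B \<epsilon>g (s n) \<and>
    upper (s n) - lower (s n) \<le> (upper (s 0) - lower (s 0)) / 2 ^ n \<and>
    real (evals (s n)) \<le> (8 * \<bar>C\<bar> + 6) * M + real n * ((4 * \<bar>C\<bar> + 4) * M)"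
  using assms(7)
proof (induction n)
  case 0
  have "bisec_init C B \<epsilon>f \<epsilon>g (s 0)"
    using run by (simp add: bisec_run_def)
  then show ?case
    using bisec_init_inv(1)[OF B \<open>\<epsilon>g > 0\<close>] bisec_init_evals_le M by auto
next
  case (Suc n)
  then have IH: "bisec_inv B \<epsilon>g (s n)"
    "upper (s n) - lower (s n) \<le> (upper (s 0) - lower (s 0)) / 2 ^ n"
    "real (evals (s n)) \<le> (8 * \<bar>C\<bar> + 6) * M + real n * ((4 * \<bar>C\<bar> + 4) * M)"
    by auto
  \<comment> \<open>A run is constrained only while the gap exceeds \<open>\<epsilon>f\<close>.
    Requiring this strictly before the index lets the estimates reach the halting state
    itself.\<close>
  have step: "bisec_step C B \<epsilon>g (s n) (s (Suc n))"
    using run Suc.prems[of n] by (simp add: bisec_run_def)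
  have "upper (s (Suc n)) - lower (s (Suc n)) \<le> (upper (s 0) - lower (s 0)) / 2 ^ n / 2"
    by (rule order_trans[OF bisec_step_inv(2)[OF B IH(1) step]])
      (intro divide_right_mono IH(2), simp)
  moreover have "real (evals (s (Suc n)))
      \<le> (8 * \<bar>C\<bar> + 6) * M + (real n * ((4 * \<bar>C\<bar> + 4) * M) + (4 * \<bar>C\<bar> + 4) * M)"
    using bisec_step_evals_le[OF step M(1,3)] IH(3) by linarith
  ultimately show ?case
    using bisec_step_inv(1)[OF B IH(1) step] by (simp add: algebra_simps)
qed

text \<open>The geometric bound is available only while all earlier values exceed the threshold. If
  none were small it would hold at every index and drive \<open>w\<close> below \<epsilon>, so a
  least small index exists.\<close>

lemma first_halving_index:
  fixes w :: "nat \<Rightarrow> real"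
  assumes "\<epsilon> > 0" and "0 \<le> w 0"
    and halving: "\<And>n. (\<And>m. m < n \<Longrightarrow> w m > \<epsilon>) \<Longrightarrow> w n \<le> w 0 / 2 ^ n"
  obtains N where "w N \<le> \<epsilon>" "\<And>n. n < N \<Longrightarrow> w n > \<epsilon>" "real N \<le> 1 + log 2 (2 + w 0 / \<epsilon>)"
proof -
  have "\<exists>n. w n \<le> \<epsilon>"
  proof (rule ccontr)
    assume "\<not> (\<exists>n. w n \<le> \<epsilon>)"
    then have big: "w n > \<epsilon>" for n
      by (auto simp: not_le)
    obtain n where "w 0 / \<epsilon> < 2 ^ n"
      using real_arch_pow[of 2] by auto
    then have "w 0 / 2 ^ n < \<epsilon>"
      using \<open>\<epsilon> > 0\<close> by (simp add: field_simps)
    then show False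
      using halving[of n] big[of n] big by force
  qed
  define N where "N = (LEAST n. w n \<le> \<epsilon>)"
  have N: "w N \<le> \<epsilon>"
    unfolding N_def by (rule LeastI_ex) fact
  have before: "w n > \<epsilon>" if "n < N" for n
    using not_less_Least[of n "\<lambda>n. w n \<le> \<epsilon>"] that by (simp add: N_def)
  have pos: "0 \<le> w 0 / \<epsilon>"
    using assms by simp
  have "real N \<le> 1 + log 2 (2 + w 0 / \<epsilon>)"
  proof (cases N)
    case 0
    then show ?thesis using pos by simp
  next
    case (Suc k)
    \<comment> \<open>The bound is read at the predecessor of the first small index, where
      \<open>w\<close> is still large; this accounts for the extra 1 in the count.\<close>
    have "\<epsilon> < w 0 / 2 ^ k"
      using before[of k] halving[of k] before Suc by force
    then have "2 ^ k \<le> 2 + w 0 / \<epsilon>"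
      using \<open>\<epsilon> > 0\<close> by (simp add: field_simps)
    then have "real k \<le> log 2 (2 + w 0 / \<epsilon>)"
      using pos by (subst le_log_iff) (auto simp: powr_realpow)
    then show ?thesis using Suc by simp
  qed
  with N before show thesis by (rule that)
qed

theorem theorem1:
  fixes C :: real
  shows "\<exists>K>0. \<forall>(B :: 'a::euclidean_space bilevel) \<epsilon>f \<epsilon>g s.
     bilevel_assms B \<longrightarrow> \<epsilon>f > 0 \<longrightarrow> \<epsilon>g > 0 \<longrightarrow> bisec_run C B \<epsilon>f \<epsilon>g s \<longrightarrow>
     (\<exists>N. halts_at \<epsilon>f s N \<and>
        obj_f B (incumbent (s N)) - opt_value B \<le> ereal \<epsilon>f \<and>
        obj_g B (incumbent (s N)) - (INF x. obj_g B x) \<le> ereal \<epsilon>g \<and>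
        real (evals (s N)) \<le> K * max 1 (max (sqrt (Lf B / \<epsilon>f)) (sqrt (Lg B / \<epsilon>g)))
          * log 2 (2 + (upper (s 0) - lower (s 0)) / \<epsilon>f))"
proof (intro exI[of _ "16 * \<bar>C\<bar> + 14"] conjI allI impI)
  \<comment> \<open>The witness is the initial cost \<open>8 * \<bar>C\<bar> + 6\<close> plus twice
    the cost \<open>4 * \<bar>C\<bar> + 4\<close> of a step.\<close>
  show "0 < 16 * \<bar>C\<bar> + 14" by simp
next
  fix B :: "'a bilevel" and \<epsilon>f \<epsilon>g s
  assume B: "bilevel_assms B" and pos: "\<epsilon>f > 0" "\<epsilon>g > 0" and run: "bisec_run C B \<epsilon>f \<epsilon>g s"
  define M where "M = max 1 (max (sqrt (Lf B / \<epsilon>f)) (sqrt (Lg B / \<epsilon>g)))"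
  define w where "w n = upper (s n) - lower (s n)" for n
  define l where "l = log 2 (2 + w 0 / \<epsilon>f)"
  have M: "1 \<le> M" "sqrt (Lf B / \<epsilon>f) \<le> M" "sqrt (Lg B / \<epsilon>g) \<le> M"
    by (auto simp: M_def)
  have w0: "0 \<le> w 0"
    using bisec_init_inv(2)[OF B pos(2), of C \<epsilon>f "s 0"] run by (simp add: bisec_run_def w_def)
  note prefix = bisec_run_prefix[OF B pos(2) run M, folded w_def]
  obtain N where N: "w N \<le> \<epsilon>f" "\<And>n. n < N \<Longrightarrow> w n > \<epsilon>f" "real N \<le> 1 + l"
    using first_halving_index[of \<epsilon>f w, OF pos(1) w0] prefix unfolding l_def by blast
  have inv: "bisec_inv B \<epsilon>g (s N)"
    and ev: "real (evals (s N)) \<le> (8 * \<bar>C\<bar> + 6) * M + real N * ((4 * \<bar>C\<bar> + 4) * M)"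
    using prefix[of N] N(2) by auto
  \<comment> \<open>The summand 2 inside the logarithm ensures this. It turns the step count
    \<open>1 + l\<close> into at most \<open>2 * l\<close> and lets the initial cost be multiplied
    by \<open>l\<close>.\<close>
  have "l \<ge> 1"
    using w0 pos unfolding l_def by (subst one_le_log_cancel_iff) (auto simp: add_pos_nonneg)
  have "real (evals (s N)) \<le> (8 * \<bar>C\<bar> + 6) * M + (2 * l) * ((4 * \<bar>C\<bar> + 4) * M)"
    using N(3) M \<open>l \<ge> 1\<close> by (intro order_trans[OF ev] add_left_mono mult_right_mono) auto
  also have "\<dots> \<le> (8 * \<bar>C\<bar> + 6) * M * l + (2 * l) * ((4 * \<bar>C\<bar> + 4) * M)"
    using M \<open>l \<ge> 1\<close> mult_left_mono[of 1 l "(8 * \<bar>C\<bar> + 6) * M"] by simp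
  also have "\<dots> = (16 * \<bar>C\<bar> + 14) * M * l"
    by (simp add: algebra_simps)
  finally have "real (evals (s N)) \<le> (16 * \<bar>C\<bar> + 14) * M * l" .
  moreover have "halts_at \<epsilon>f s N"
    using N by (simp add: halts_at_def w_def)
  moreover have "obj_f B (incumbent (s N)) - opt_value B \<le> ereal \<epsilon>f"
  proof -
    \<comment> \<open>Monotonicity of subtraction, unlike cancellation, also covers an infinite
      \<open>opt_value B\<close>.\<close>
    have "obj_f B (incumbent (s N)) - opt_value B \<le> ereal (upper (s N)) - ereal (lower (s N))"
      using inv by (intro ereal_minus_mono) (auto simp: bisec_inv_def)
    also have "\<dots> \<le> ereal \<epsilon>f" using N(1) by (simp add: w_def)
    finally show ?thesis .
  qed
  moreover have "obj_g B (incumbent (s N)) - (INF x. obj_g B x) \<le> ereal \<epsilon>g"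
  proof -
    obtain r where r: "(INF x. obj_g B x) = ereal r"
      using INF_obj_g_finite[OF B] by auto
    \<comment> \<open>One half of \<open>\<epsilon>g\<close> comes from the acceptance test, the
      other from the initial approximation of the infimum of g.\<close>
    have "obj_g B (incumbent (s N)) \<le> ereal (gtilde (s N) + \<epsilon>g / 2)"
      and "gtilde (s N) \<le> r + \<epsilon>g / 2"
      using inv by (auto simp: bisec_inv_def r)
    then show ?thesis
      unfolding r by (cases "obj_g B (incumbent (s N))") auto
  qed
  ultimately show "\<exists>N. halts_at \<epsilon>f s N \<and>
        obj_f B (incumbent (s N)) - opt_value B \<le> ereal \<epsilon>f \<and>
        obj_g B (incumbent (s N)) - (INF x. obj_g B x) \<le> ereal \<epsilon>g \<and>
        real (evals (s N)) \<le> (16 * \<bar>C\<bar> + 14) * max 1 (max (sqrt (Lf B / \<epsilon>f)) (sqrt (Lg B / \<epsilon>g)))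
          * log 2 (2 + (upper (s 0) - lower (s 0)) / \<epsilon>f)"
    unfolding M_def l_def w_def by blast
qed

end
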